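(* Let $q$ be a prime power, let $n \geq 1$, and let $d, e \geq 2$ be integers with $q > 2e$. Put $s = d(e-1)$ and $r = de-1$. Let $X$ be an $(r,s)$-set in $\mathrm{PG}(n,q)$. Then \[ |X| \leq C_{d,e}\, q^{\frac{n-e+1}{e}} + e, \qquad \text{where } C_{d,e} = \sqrt[e]{e!\,(d-1)\,\frac{1+2q^{-1}}{1-2eq^{-1}}}. \] In particular, if $s = r-1$ is even (so $d=2$, $e = s/2+1$), then $|X| \leq C_{2,e}\, q^{\frac{n-e+1}{e}} + e = C_{2,e}\, q^{\frac{2n-s}{s+2}} + e$; and if $r = 2s-1$ (so $e=2$, $d=s$), then $|X| \leq C_{d,2}\, q^{\frac{1}{2}(n-1)} + e$.
   Context: $\mathrm{PG}(n,q)$ is the projective space whose points are the $1$-dimensional subspaces of $\mathbb{F}_q^{n+1}$; a $k$-space is a $(k+1)$-dimensional vector subspace (projective dimension $k$). An $(r,s)$-set in $\mathrm{PG}(n,q)$ is a set $X$ of points such that every $s$-space contains at most $r$ points of $X$.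
   Formalization: The formal theorem adds the assumption s ≤ n; for s > n there are no s-spaces, every point set is vacuously an (r,s)-set, and the bound can fail (n=1, d=e=2, q=5, X the whole line). *)

theory Defs
  imports "HOL-Analysis.Analysis"
begin

text \<open>
  Over a finite field \<open>'a\<close> of order \<open>q = CARD('a)\<close> and an index type with
  \<open>CARD('n) = n + 1\<close>, the subspaces of \<open>'a ^ 'n\<close> form the projective space
  \<open>PG(n,q)\<close>. Below \<open>k\<close> is the projective dimension, so the vector space dimension
  is \<open>k + 1\<close>.
\<close>

definition proj_space :: "nat \<Rightarrow> ('a::field ^ 'n) set \<Rightarrow> bool" where
  "proj_space k S \<longleftrightarrow> vec.subspace S \<and> vec.dim S = k + 1"

definition proj_points :: "('a::field ^ 'n) set set" where
  "proj_points = {P. vec.subspace P \<and> vec.dim P = 1}"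

definition rs_set :: "nat \<Rightarrow> nat \<Rightarrow> ('a::{field,finite} ^ 'n) set set \<Rightarrow> bool" where
  "rs_set r s X \<longleftrightarrow>
     X \<subseteq> proj_points \<and> (\<forall>S. proj_space s S \<longrightarrow> card {P \<in> X. P \<subseteq> S} \<le> r)"

text \<open>The constant depends on \<open>q\<close> as well as on \<open>d\<close> and \<open>e\<close>.\<close>

definition C_const :: "nat \<Rightarrow> nat \<Rightarrow> nat \<Rightarrow> real" where
  "C_const q d e =
     root e (fact e * (real d - 1) * ((1 + 2 * inverse (real q)) / (1 - 2 * real e * inverse (real q))))"

end

theory Submission
  imports Defs
begin

text \<open>
  Represent the points of \<open>X\<close> by a set \<open>V\<close> of vectors, so that any \<open>de\<close> of them span dimension at
  least \<open>d(e-1) + 2\<close>. If a vector \<open>v\<close> is a combination with nonzero coefficients of each of \<open>d\<close>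
  pairwise disjoint \<open>e\<close>-subsets of \<open>V\<close>, then dropping one element of each subset and adding \<open>v\<close>
  leaves \<open>d(e-1) + 1\<close> vectors that span their union, which is impossible. Call an \<open>e\<close>-set \<open>A\<close> good (\<open>general_position_in V A\<close>)
  if no \<open>y \<in> A\<close> lies in the span of \<open>A - {y}\<close> and fewer than \<open>e\<close> further elements of \<open>V\<close> other
  than \<open>y\<close>. Good sets through a common \<open>v\<close> are automatically disjoint, so counting pairs \<open>(A, v)\<close>
  gives \<open>|good| (q-1)^e \<le> (d-1) q^(n+1)\<close>.

  Few \<open>e\<close>-sets are not good: starting from \<open>W\<close> with \<open>e-1\<close> elements, each \<open>y\<close> that spoils
  \<open>W \<union> {y}\<close> and has not been absorbed yet enlarges the current set by at most \<open>e\<close> elements and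
  raises its nullity. After \<open>d-1\<close> rounds there would be at most \<open>de\<close> elements of nullity \<open>d-1\<close>;
  hence only \<open>(d-2)e\<close> such \<open>y\<close> exist for each \<open>W\<close>. This loss fits into the slack between
  \<open>1 - e/q\<close> and \<open>1 - 2e/q\<close>, since \<open>n \<ge> d(e-1)\<close> makes the claimed bound at least
  \<open>(d-2)eq\<close>.
\<close>

section \<open>Linear algebra: dimension growth and extension of subspaces\<close>

lemma dim_Un_le_dim_plus_card:
  fixes U T :: "('a::field ^ 'n) set"
  assumes "finite T"
  shows "vec.dim (U \<union> T) \<le> vec.dim U + card (T - U)"
proof -
  have "vec.dim (U \<union> S) \<le> vec.dim U + card S" if "finite S" for S
    using that
  proof (induction S)
    case (insert x S)
    then show ?case by (auto simp: vec.dim_insert)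
  qed simp
  from this[of "T - U"] assms show ?thesis by simp
qed

text \<open>The \<open>(r,s)\<close>-condition speaks only of subspaces of one fixed dimension, so a
  set of smaller dimension has to be enlarged before the condition applies to it.\<close>

lemma subspace_superset_of_dim:
  fixes U :: "('a::field ^ 'n) set"
  assumes "vec.dim U \<le> k" "k \<le> CARD('n)"
  obtains S where "vec.subspace S" "U \<subseteq> S" "vec.dim S = k"
proof -
  have "\<exists>S. vec.subspace S \<and> U \<subseteq> S \<and> vec.dim S = k" using assms
  proof (induction k rule: dec_induct)
    case base
    show ?case using vec.span_superset vec.dim_span vec.subspace_span by metis
  next
    case (step k)
    then obtain S where S: "vec.subspace S" "U \<subseteq> S" "vec.dim S = k" by auto
    with step have "S \<noteq> UNIV" using vec_dim_card by (metis Suc_n_not_le_n)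
    then obtain x where "x \<notin> S" by auto
    with S have "vec.dim (insert x S) = Suc k"
      by (simp add: vec.dim_insert vec.span_eq_iff[THEN iffD2])
    moreover have "U \<subseteq> vec.span (insert x S)"
      using S(2) vec.span_superset by blast
    ultimately show ?case by (metis vec.dim_span vec.subspace_span)
  qed
  with that show ?thesis by blast
qed

section \<open>Combinations with nonzero coefficients, and sets in general position\<close>

text \<open>The coefficient functions are extensional, so that for independent \<open>A\<close> they
  correspond bijectively to the vectors and \<open>card_PiE\<close> counts them.\<close>

definition span_interior :: "('a::field ^ 'n) set \<Rightarrow> ('a ^ 'n) set" where
  "span_interior A = (\<lambda>c. \<Sum>a\<in>A. c a *s a) ` (A \<rightarrow>\<^sub>E (UNIV - {0}))"

lemma card_span_interior:
  fixes A :: "('a::{field,finite} ^ 'n) set"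
  assumes "\<not> vec.dependent A"
  shows "card (span_interior A) = (CARD('a) - 1) ^ card A"
proof -
  have "inj_on (\<lambda>c. \<Sum>a\<in>A. c a *s a) (A \<rightarrow>\<^sub>E (UNIV - {0}))"
  proof (rule inj_onI)
    fix c c' assume c: "c \<in> A \<rightarrow>\<^sub>E (UNIV - {0})" and c': "c' \<in> A \<rightarrow>\<^sub>E (UNIV - {0})"
      and eq: "(\<Sum>a\<in>A. c a *s a) = (\<Sum>a\<in>A. c' a *s a)"
    have "(\<Sum>a\<in>A. (c a - c' a) *s a) = 0"
      using eq by (simp add: vector_sub_rdistrib sum_subtractf)
    then have "c a - c' a = 0" if "a \<in> A" for a
      using vec.independentD[OF assms, of A "\<lambda>a. c a - c' a" a] that by auto
    then show "c = c'" by (intro PiE_ext[OF c c']) auto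
  qed
  then show ?thesis
    unfolding span_interior_def by (simp add: card_image card_PiE card_Diff_subset)
qed

lemma span_interior_subset_span: "span_interior A \<subseteq> vec.span A"
  unfolding span_interior_def by (auto intro!: vec.span_sum vec.span_scale intro: vec.span_base)

text \<open>Exchange: the coefficient of \<open>a\<close> is nonzero, so the combination can be
  solved for \<open>a\<close>.\<close>

lemma in_span_of_span_interior:
  fixes A :: "('a::{field,finite} ^ 'n) set"
  assumes "v \<in> span_interior A" "a \<in> A"
  shows "a \<in> vec.span (insert v (A - {a}))"
proof -
  from assms obtain c where c: "c a \<noteq> 0" and v: "v = (\<Sum>a\<in>A. c a *s a)"
    by (auto simp: span_interior_def PiE_def Pi_def)
  have "v = c a *s a + (\<Sum>b\<in>A-{a}. c b *s b)"
    unfolding v using assms(2) by (intro sum.remove) auto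
  then have "c a *s a = v - (\<Sum>b\<in>A-{a}. c b *s b)" by simp
  moreover have "v - (\<Sum>b\<in>A-{a}. c b *s b) \<in> vec.span (insert v (A - {a}))"
    by (intro vec.span_diff vec.span_sum vec.span_scale) (auto intro: vec.span_base)
  ultimately have "inverse (c a) *s (c a *s a) \<in> vec.span (insert v (A - {a}))"
    by (metis vec.span_scale)
  with c show ?thesis by (simp add: vector_smult_assoc)
qed

text \<open>\<open>T\<close> may overlap \<open>A\<close>. The strict bound on \<open>card T\<close>
  serves two purposes: \<open>B - A\<close> is an admissible \<open>T\<close> as soon as
  \<open>B\<close> has the size of \<open>A\<close> and meets it, and adjoining \<open>y\<close>
  together with \<open>T\<close> costs at most \<open>card A\<close> elements.\<close>

definition general_position_in ::
    "('a::field ^ 'n) set \<Rightarrow> ('a ^ 'n) set \<Rightarrow> bool" where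
  "general_position_in V A \<longleftrightarrow>
     (\<forall>y\<in>A. \<forall>T\<subseteq>V. card T < card A \<longrightarrow> y \<notin> T \<longrightarrow> y \<notin> vec.span (A - {y} \<union> T))"

lemma independent_if_general_position_in:
  assumes "general_position_in V A"
  shows "\<not> vec.dependent (A :: ('a::{field,finite} ^ 'n) set)"
proof
  assume "vec.dependent A"
  then obtain y where y: "y \<in> A" "y \<in> vec.span (A - {y})" by (auto simp: vec.dependent_def)
  \<comment> \<open>Independence is the case \<open>T = {}\<close>, which is admissible because
    \<open>A\<close> is nonempty.\<close>
  then have "card ({} :: ('a ^ 'n) set) < card A" by (auto simp: card_gt_0_iff)
  with y assms show False unfolding general_position_in_def by (metis empty_iff empty_subsetI sup_bot_right)
qed

text \<open>If \<open>A\<close> and \<open>B\<close> met, \<open>B - A\<close> would have fewer than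
  \<open>card A\<close> elements. For \<open>y\<close> in \<open>A\<close> outside \<open>B\<close>,
  the vector \<open>v\<close> lies in the span of \<open>B\<close>, hence of \<open>A - {y}\<close>
  and \<open>B - A\<close>, and exchange puts \<open>y\<close> there too, against the general
  position of \<open>A\<close>.\<close>

lemma general_position_in_disjoint:
  fixes A B :: "('a::{field,finite} ^ 'n) set"
  assumes A: "general_position_in V A" and B: "B \<subseteq> V" "card B = card A" and "A \<noteq> B"
    and v: "v \<in> span_interior A" "v \<in> span_interior B"
  shows "A \<inter> B = {}"
proof (rule ccontr)
  assume "A \<inter> B \<noteq> {}"
  then have "B - A \<subset> B" by auto
  then have "card (B - A) < card A" using B by (metis finite psubset_card_mono)
  obtain y where y: "y \<in> A" "y \<notin> B"
    using \<open>A \<noteq> B\<close> B(2) by (metis card_subset_eq finite subsetI)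
  have "B \<subseteq> A - {y} \<union> (B - A)" using y by auto
  then have "v \<in> vec.span (A - {y} \<union> (B - A))"
    using v(2) span_interior_subset_span vec.span_mono by blast
  then have "insert v (A - {y}) \<subseteq> vec.span (A - {y} \<union> (B - A))"
    by (auto intro: vec.span_base)
  then have "y \<in> vec.span (A - {y} \<union> (B - A))"
    using in_span_of_span_interior[OF v(1) y(1)] vec.span_minimal[OF _ vec.subspace_span] by blast
  with A y B \<open>card (B - A) < card A\<close> show False
    unfolding general_position_in_def by blast
qed

lemma card_general_position_through_le:
  fixes V :: "('a::{field,finite} ^ 'n) set"
  assumes H: "\<And>U. U \<subseteq> V \<Longrightarrow> card U = d * e \<Longrightarrow> d * (e - 1) + 1 < vec.dim U"
    and "d \<ge> 1" "e \<ge> 1"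
  shows "card {A. A \<subseteq> V \<and> card A = e \<and> general_position_in V A \<and> v \<in> span_interior A} \<le> d - 1"
    (is "card ?F \<le> _")
proof (rule ccontr)
  assume "\<not> card ?F \<le> d - 1"
  then have "d \<le> card ?F" by simp
  then obtain F where F: "F \<subseteq> ?F" "card F = d" by (meson obtain_subset_with_card_n)
  have disj: "A \<inter> B = {}" if "A \<in> F" "B \<in> F" "A \<noteq> B" for A B
    using that F(1) by (intro general_position_in_disjoint[of V A B v]) auto
  have "A \<noteq> {}" if "A \<in> F" for A using that F(1) \<open>e \<ge> 1\<close> by auto
  then have "\<forall>A\<in>F. \<exists>a. a \<in> A" by blast
  then obtain f where f: "\<And>A. A \<in> F \<Longrightarrow> f A \<in> A" by metis
  have cU: "card (\<Union>F) = d * e"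
    using F card_Union_disjoint[of F] disj by (auto simp: pairwise_def disjnt_def subset_iff)
  \<comment> \<open>Disjointness makes the \<open>d\<close> chosen representatives distinct, so
    dropping them saves exactly \<open>d\<close> vectors at the cost of the single vector
    \<open>v\<close>.\<close>
  have "inj_on f F" using f disj by (intro inj_onI) (metis IntI empty_iff)
  then have cf: "card (f ` F) = d" using F by (simp add: card_image)
  let ?T = "insert v (\<Union>F - f ` F)"
  have "\<Union>F \<subseteq> vec.span ?T"
  proof
    fix x assume "x \<in> \<Union>F"
    then obtain A where A: "A \<in> F" "x \<in> A" by auto
    show "x \<in> vec.span ?T"
    proof (cases "x \<in> f ` F")
      case True
      then have x: "x = f A" using A f disj by (metis IntI empty_iff imageE)
      \<comment> \<open>By disjointness, \<open>A\<close> loses only its own representative, which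
        exchange recovers from \<open>v\<close>.\<close>
      have "insert v (A - {f A}) \<subseteq> ?T" using A disj f by blast
      then show ?thesis
        using in_span_of_span_interior[of v A x] A F(1) x vec.span_mono by blast
    qed (use \<open>x \<in> \<Union>F\<close> in \<open>auto intro: vec.span_base\<close>)
  qed
  then have "vec.dim (\<Union>F) \<le> card ?T" by (intro vec.dim_le_card) auto
  also have "\<dots> \<le> 1 + card (\<Union>F - f ` F)" by (simp add: card_insert_if)
  also have "card (\<Union>F - f ` F) = d * e - d"
    using f by (subst card_Diff_subset) (auto simp: cU cf)
  finally have "vec.dim (\<Union>F) \<le> d * (e - 1) + 1" by (simp add: algebra_simps)
  moreover have "\<Union>F \<subseteq> V" using F(1) by auto
  ultimately show False using H[of "\<Union>F"] cU by simp
qed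

section \<open>Counting the sets that are not in general position\<close>

text \<open>The induction tracks the nullity, cardinality minus dimension. Adjoining
  \<open>y\<close> and \<open>T\<close> adds \<open>card (T - U) + 1\<close> elements, at most
  \<open>e\<close>, but raises the dimension by at most \<open>card (T - U)\<close>, because
  \<open>y\<close> already lies in the span of \<open>U \<union> T\<close>.\<close>

lemma card_dependent_completions_le:
  fixes V :: "('a::{field,finite} ^ 'n) set"
  assumes H: "\<And>U. U \<subseteq> V \<Longrightarrow> card U = d * e \<Longrightarrow> d * (e - 1) + 1 < vec.dim U"
    and "d \<ge> 2" "e \<ge> 1" and V: "d * e \<le> card V" and W: "W \<subseteq> V" "card W = e - 1"
  shows "card {y \<in> V - W. \<exists>T\<subseteq>V. card T < e \<and> y \<notin> T \<and> y \<in> vec.span (W \<union> T)} \<le> (d - 2) * e"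
    (is "card ?Y \<le> _")
proof (rule ccontr)
  assume "\<not> card ?Y \<le> (d - 2) * e"
  then have Y: "card ?Y > (d - 2) * e" by simp
  have "\<exists>U. W \<subseteq> U \<and> U \<subseteq> V \<and> card U \<le> e - 1 + k * e \<and> vec.dim U + k \<le> card U"
    if "k \<le> d - 1" for k using that
  proof (induction k)
    case 0
    show ?case using W vec.dim_le_card[of W W] by (intro exI[of _ W]) (auto simp: vec.span_superset)
  next
    case (Suc k)
    then obtain U where U: "W \<subseteq> U" "U \<subseteq> V" "card U \<le> e - 1 + k * e" "vec.dim U + k \<le> card U"
      by auto
    \<comment> \<open>In this step \<open>k \<le> d - 2\<close>, so \<open>U - W\<close> is too
      small to absorb all of \<open>?Y\<close>, and a new \<open>y\<close> exists.\<close>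
    have "card (U - W) \<le> k * e" using U W by (subst card_Diff_subset) auto
    also have "\<dots> \<le> (d - 2) * e" using Suc.prems by (intro mult_right_mono) auto
    finally have "\<not> ?Y \<subseteq> U - W" using Y card_mono[of "U - W" ?Y] by auto
    then obtain y T where y: "y \<in> V" "y \<notin> U" and T: "T \<subseteq> V" "card T < e" "y \<notin> T"
      "y \<in> vec.span (W \<union> T)" by auto
    let ?U = "insert y (U \<union> T)"
    have "y \<in> vec.span (U \<union> T)" using T(4) U(1) vec.span_mono[of "W \<union> T" "U \<union> T"] by blast
    then have "vec.dim ?U = vec.dim (U \<union> T)" by (simp add: vec.dim_insert)
    also have "\<dots> \<le> vec.dim U + card (T - U)" by (simp add: dim_Un_le_dim_plus_card)
    finally have d: "vec.dim ?U \<le> vec.dim U + card (T - U)" .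
    have "card (U \<union> T) = card U + card (T - U)"
      by (metis Diff_disjoint Un_Diff_cancel card_Un_disjoint finite)
    then have c: "card ?U = card U + card (T - U) + 1" using y T by simp
    have "card (T - U) \<le> card T" by (simp add: card_mono)
    then have "card ?U \<le> e - 1 + Suc k * e" using c U(3) T(2) by simp
    moreover have "vec.dim ?U + Suc k \<le> card ?U" using c d U(4) by simp
    ultimately show ?case using U y T by (intro exI[of _ ?U]) auto
  qed
  from this[of "d - 1"] obtain U where U: "U \<subseteq> V" "card U \<le> e - 1 + (d - 1) * e"
    "vec.dim U + (d - 1) \<le> card U" by auto
  have "e + (d - 1) * e = d * e" using \<open>d \<ge> 2\<close> by (cases d) auto
  then have "card U \<le> d * e" using U by simp
  \<comment> \<open>\<open>H\<close> concerns sets of exactly \<open>d * e\<close> elements. Padding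
    raises the dimension by at most the number of added elements, so the nullity stays at least
    \<open>d - 1\<close>.\<close>
  then obtain U' where U': "U \<subseteq> U'" "U' \<subseteq> V" "card U' = d * e"
    using exists_subset_between[of U "d * e" V] U V by auto
  have "vec.dim U' = vec.dim (U \<union> U')" using U' by (simp add: Un_absorb1)
  also have "\<dots> \<le> vec.dim U + card (U' - U)" by (simp add: dim_Un_le_dim_plus_card)
  also have "card (U' - U) = d * e - card U" using U' by (simp add: card_Diff_subset)
  finally have "vec.dim U' + (d - 1) \<le> d * e" using U \<open>card U \<le> d * e\<close> by simp
  moreover have "d * e = d * (e - 1) + d" using \<open>e \<ge> 1\<close> by (cases e) auto
  ultimately have "vec.dim U' \<le> d * (e - 1) + 1" using \<open>d \<ge> 2\<close> by simp
  with H[of U'] U' show False by simp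
qed

text \<open>An \<open>e\<close>-set that is not in general position has the form
  \<open>insert y W\<close> with \<open>y\<close> a spoiling completion of the
  \<open>(e-1)\<close>-set \<open>W\<close>; these pairs are counted by \<open>W\<close>.\<close>

lemma choose_minus_card_general_position_le:
  fixes V :: "('a::{field,finite} ^ 'n) set"
  assumes H: "\<And>U. U \<subseteq> V \<Longrightarrow> card U = d * e \<Longrightarrow> d * (e - 1) + 1 < vec.dim U"
    and "d \<ge> 2" "e \<ge> 1" and V: "d * e \<le> card V"
  shows "card V choose e
    \<le> card {A. A \<subseteq> V \<and> card A = e \<and> general_position_in V A} + (card V choose (e - 1)) * ((d - 2) * e)"
    (is "_ \<le> card ?G + _")
proof -
  let ?Ws = "{W. W \<subseteq> V \<and> card W = e - 1}"
  let ?Y = "\<lambda>W. {y \<in> V - W. \<exists>T\<subseteq>V. card T < e \<and> y \<notin> T \<and> y \<in> vec.span (W \<union> T)}"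
  let ?E = "\<Union>W\<in>?Ws. (\<lambda>y. insert y W) ` ?Y W"
  have "{A. A \<subseteq> V \<and> card A = e} \<subseteq> ?G \<union> ?E"
  proof
    fix A assume A: "A \<in> {A. A \<subseteq> V \<and> card A = e}"
    show "A \<in> ?G \<union> ?E"
    proof (cases "general_position_in V A")
      case False
      then obtain y T where y: "y \<in> A" "T \<subseteq> V" "card T < e" "y \<notin> T" "y \<in> vec.span (A - {y} \<union> T)"
        using A by (auto simp: general_position_in_def)
      then have "A - {y} \<in> ?Ws" "y \<in> ?Y (A - {y})" "A = insert y (A - {y})" using A by auto
      then show ?thesis by blast
    qed (use A in auto)
  qed
  then have "card {A. A \<subseteq> V \<and> card A = e} \<le> card (?G \<union> ?E)" by (intro card_mono) auto
  also have "\<dots> \<le> card ?G + card ?E" by (rule card_Un_le)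
  also have "card ?E \<le> (\<Sum>W\<in>?Ws. card ((\<lambda>y. insert y W) ` ?Y W))" by (intro card_UN_le) auto
  also have "\<dots> \<le> (\<Sum>W\<in>?Ws. (d - 2) * e)"
    using card_dependent_completions_le[OF H \<open>d \<ge> 2\<close> \<open>e \<ge> 1\<close> V]
    by (intro sum_mono order.trans[OF card_image_le]) auto
  finally show ?thesis by (simp add: n_subsets)
qed

text \<open>Double counting of pairs \<open>(A, v)\<close>: independence makes every
  \<open>A\<close> contribute exactly \<open>(q-1)^e\<close> vectors, with
  \<open>q = CARD('a)\<close>.\<close>

lemma general_position_count:
  fixes V :: "('a::{field,finite} ^ 'n) set"
  assumes H: "\<And>U. U \<subseteq> V \<Longrightarrow> card U = d * e \<Longrightarrow> d * (e - 1) + 1 < vec.dim U"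
    and "d \<ge> 1" "e \<ge> 1"
  shows "card {A. A \<subseteq> V \<and> card A = e \<and> general_position_in V A} * (CARD('a) - 1) ^ e
    \<le> (d - 1) * CARD('a) ^ CARD('n)" (is "card ?G * _ \<le> _")
proof -
  have "card ?G * (CARD('a) - 1) ^ e = (\<Sum>A\<in>?G. card (span_interior A))"
    by (simp add: card_span_interior[OF independent_if_general_position_in[of V]])
  also have "\<dots> = (\<Sum>A\<in>?G. card {v \<in> UNIV. v \<in> span_interior A})" by simp
  also have "\<dots> = (\<Sum>v\<in>UNIV. card {A \<in> ?G. v \<in> span_interior A})"
    by (rule sum_multicount_gen) auto
  also have "\<dots> \<le> (\<Sum>v\<in>(UNIV :: ('a ^ 'n) set). d - 1)"
    using card_general_position_through_le[OF assms]
    by (intro sum_mono) (simp add: conj_assoc)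
  finally show ?thesis by (simp add: mult.commute)
qed

section \<open>Numerical estimates\<close>

lemma Suc_mult_choose_Suc: "Suc k * (N choose Suc k) = (N - k) * (N choose k)"
  by (simp only: binomial_absorption binomial_absorb_comp)

text \<open>The right side is the falling factorial \<open>N (N-1) ... (N-k+1)\<close>; for
  \<open>k \<le> N\<close> each of its \<open>k\<close> factors exceeds
  \<open>N - k\<close>.\<close>

lemma power_diff_le_fact_mult_choose: "(N - k) ^ k \<le> fact k * (N choose k)"
proof (induction k)
  case (Suc k)
  have "(N - Suc k) ^ Suc k \<le> (N - k) ^ Suc k" by (intro power_mono) auto
  also have "\<dots> \<le> (N - k) * (fact k * (N choose k))" using Suc by simp
  also have "\<dots> = fact k * (Suc k * (N choose Suc k))"
    by (simp only: Suc_mult_choose_Suc mult_ac)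
  finally show ?case by (simp add: algebra_simps)
qed simp

text \<open>Common induction step of the next two lemmas: passing from \<open>k\<close> to
  \<open>k + 1\<close> at most doubles the base, and
  \<open>2^e \<le> (2e)^(e-1) \<le> q^(e-1)\<close>.\<close>

lemma power_Suc_mult_le:
  fixes a e k q :: nat
  assumes "k \<ge> 1" "e \<ge> 2" "2 * e \<le> q"
  shows "(Suc k * a) ^ e \<le> q ^ (e - 1) * (k * a) ^ e"
proof -
  obtain f where f: "e = Suc (Suc f)" using assms(2) by (metis Suc_le_D numeral_2_eq_2 Suc_le_mono)
  have "(2::nat) ^ e = 2 * 2 * 2 ^ f" by (simp add: f)
  also have "\<dots> \<le> (2 * e) * (2 * e) ^ f" using assms by (intro mult_mono power_mono) auto
  also have "\<dots> = (2 * e) ^ (e - 1)" by (simp add: f)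
  also have "\<dots> \<le> q ^ (e - 1)" using assms by (intro power_mono) auto
  finally have "2 ^ e * (k * a) ^ e \<le> q ^ (e - 1) * (k * a) ^ e" by simp
  moreover have "(Suc k * a) ^ e \<le> (2 * k * a) ^ e" using assms by (intro power_mono mult_right_mono) auto
  moreover have "(2 * k * a) ^ e = 2 ^ e * (k * a) ^ e" by (simp only: power_mult_distrib mult.assoc)
  ultimately show ?thesis by linarith
qed

text \<open>With \<open>D = d - 1\<close> this covers the case of fewer than \<open>d * e\<close>
  points, where \<open>(d - 1) * e\<close> must lie below the main term.\<close>

lemma power_mult_le_fact_mult_power:
  fixes D e q :: nat
  assumes "D \<ge> 1" "e \<ge> 2" "2 * e \<le> q"
  shows "(D * e) ^ e \<le> fact e * D * q ^ (D * (e - 1))"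
  using assms(1)
proof (induction D rule: dec_induct)
  case base
  have "e ^ e = e * e ^ (e - 1)" using assms by (simp add: power_eq_if)
  also have "\<dots> \<le> fact e * q ^ (e - 1)"
    using assms by (intro mult_mono power_mono fact_ge_self) auto
  finally show ?case by simp
next
  case (step k)
  have "(Suc k * e) ^ e \<le> q ^ (e - 1) * (k * e) ^ e"
    using step assms by (intro power_Suc_mult_le) auto
  also have "\<dots> \<le> q ^ (e - 1) * (fact e * k * q ^ (k * (e - 1)))" using step by simp
  also have "\<dots> = fact e * k * q ^ (Suc k * (e - 1))" by (simp add: power_add mult_ac)
  also have "\<dots> \<le> fact e * Suc k * q ^ (Suc k * (e - 1))" by (intro mult_mono) auto
  finally show ?case .
qed

text \<open>With \<open>k = d - 2\<close> this puts \<open>(d - 2) * e * q\<close> below the main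
  term, which controls the loss from sets not in general position.\<close>

lemma power_mult_base_le_fact_mult_power:
  fixes k e q :: nat
  assumes "k \<ge> 1" "e \<ge> 2" "2 * e \<le> q"
  shows "(k * (e * q)) ^ e \<le> fact e * (k + 1) * q ^ ((k + 1) * (e - 1))"
  using assms(1)
proof (induction k rule: dec_induct)
  case base
  obtain f where f: "e = Suc (Suc f)" using assms(2) by (metis Suc_le_D numeral_2_eq_2 Suc_le_mono)
  \<comment> \<open>After cancelling \<open>q^e\<close>, the base case reads
    \<open>e^e \<le> 2 * fact e * q^(e-2)\<close>. Two factors \<open>e\<close> are paid for by
    \<open>fact e * 2^(e-1)\<close>; of these powers of two, \<open>2^(e-2)\<close> joins
    \<open>e^(e-2)\<close> to give \<open>(2e)^(e-2)\<close>.\<close>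
  have "e \<le> 2 ^ Suc f" using f less_exp[of "Suc f"] by simp
  then have "e * e \<le> fact e * 2 ^ Suc f" using assms by (intro mult_mono fact_ge_self) auto
  then have "e * e * e ^ f \<le> fact e * 2 ^ Suc f * e ^ f" by simp
  moreover have "e ^ e = e * e * e ^ f" using power_add[of e 2 f] f by (simp add: power2_eq_square)
  ultimately have "e ^ e \<le> 2 * fact e * (2 * e) ^ f" by (simp add: power_mult_distrib mult_ac)
  also have "\<dots> \<le> 2 * fact e * q ^ f" using assms by (intro mult_mono power_mono) auto
  finally have "e ^ e * q ^ e \<le> 2 * fact e * q ^ f * q ^ e" by simp
  also have "\<dots> = 2 * fact e * q ^ (f + e)" by (simp add: power_add mult_ac)
  also have "f + e = (1 + 1) * (e - 1)" using f by simp
  finally show ?case by (simp only: power_mult_distrib mult_1 one_add_one mult_ac)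
next
  case (step k)
  have "(Suc k * (e * q)) ^ e \<le> q ^ (e - 1) * (k * (e * q)) ^ e"
    using step assms by (intro power_Suc_mult_le) auto
  also have "\<dots> \<le> q ^ (e - 1) * (fact e * (k + 1) * q ^ ((k + 1) * (e - 1)))" using step by simp
  also have "\<dots> = fact e * (k + 1) * q ^ ((Suc k + 1) * (e - 1))" by (simp add: power_add mult_ac)
  also have "\<dots> \<le> fact e * (Suc k + 1) * q ^ ((Suc k + 1) * (e - 1))" by (intro mult_mono) auto
  finally show ?case .
qed

text \<open>Taking the \<open>e\<close>-th power removes the root and the fractional exponent. Since
  \<open>q > 2e\<close> the radicand is nonnegative, and its fraction is expanded by
  \<open>q\<close>.\<close>

lemma C_const_mult_powr_power:
  assumes "e \<ge> 1" "d \<ge> 1" "q > 2 * e" "e \<le> n + 1"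
  shows "(C_const q d e * real q powr ((real n - real e + 1) / real e)) ^ e
    = fact e * (real d - 1) * real q ^ (n + 1 - e) * (real q + 2) / (real q - 2 * real e)"
proof -
  have q: "real q > 2 * real e" using assms(3) by (metis of_nat_less_iff of_nat_mult of_nat_numeral)
  have "1 - 2 * real e * inverse (real q) > 0" using q assms by (simp add: field_simps)
  then have "0 \<le> fact e * (real d - 1) *
      ((1 + 2 * inverse (real q)) / (1 - 2 * real e * inverse (real q)))"
    using assms by (intro mult_nonneg_nonneg divide_nonneg_pos) auto
  then have "C_const q d e ^ e = fact e * (real d - 1) *
      ((1 + 2 * inverse (real q)) / (1 - 2 * real e * inverse (real q)))"
    unfolding C_const_def using assms by (intro real_root_pow_pos2) auto
  also have "\<dots> = fact e * (real d - 1) * ((real q + 2) / (real q - 2 * real e))"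
    using q assms by (simp add: field_simps)
  finally have C: "C_const q d e ^ e = fact e * (real d - 1) * ((real q + 2) / (real q - 2 * real e))" .
  have "(real q powr ((real n - real e + 1) / real e)) ^ e = real q powr (real (n + 1 - e))"
    using assms by (simp add: powr_power of_nat_diff add.commute add_diff_eq)
  also have "\<dots> = real q ^ (n + 1 - e)" using assms by (subst powr_realpow) auto
  finally show ?thesis unfolding power_mult_distrib C by simp
qed

lemma C_const_nonneg:
  assumes "e \<ge> 1" "d \<ge> 1" "q > 2 * e"
  shows "C_const q d e \<ge> 0"
proof -
  have "real q > 2 * real e" using assms(3) by (metis of_nat_less_iff of_nat_mult of_nat_numeral)
  then have "1 - 2 * real e * inverse (real q) > 0" using assms by (simp add: field_simps)
  then show ?thesis unfolding C_const_def using assms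
    by (intro real_root_ge_zero mult_nonneg_nonneg divide_nonneg_pos) auto
qed

lemma power_le_C_const_imp_le:
  assumes "e \<ge> 2" "d \<ge> 2" "q > 2 * e" "d * (e - 1) \<le> n"
    and a: "a ^ e \<le> fact e * (d - 1) * q ^ ((d - 1) * (e - 1))"
  shows "real a \<le> C_const q d e * real q powr ((real n - real e + 1) / real e)" (is "_ \<le> ?M")
proof (rule power_le_imp_le_base[of _ "e - 1"])
  have q: "real q > 2 * real e" using assms(3) by (metis of_nat_less_iff of_nat_mult of_nat_numeral)
  obtain c where c: "d = Suc c" using assms by (cases d) auto
  \<comment> \<open>This is \<open>d * (e - 1) \<le> n\<close> with \<open>e - 1\<close> subtracted
    on both sides; the remaining factor \<open>(q + 2) / (q - 2e)\<close> is at least 1.\<close>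
  have exp: "(d - 1) * (e - 1) \<le> n + 1 - e" using assms c by simp
  have en: "e \<le> n + 1" using assms c by simp
  have "real (a ^ e) \<le> real (fact e * (d - 1) * q ^ ((d - 1) * (e - 1)))" using a by (simp only: of_nat_le_iff)
  also have "\<dots> \<le> fact e * (real d - 1) * real q ^ (n + 1 - e)"
    using exp assms by (auto simp: of_nat_diff intro!: mult_left_mono power_increasing)
  also have "\<dots> \<le> fact e * (real d - 1) * real q ^ (n + 1 - e) * ((real q + 2) / (real q - 2 * real e))"
    using q assms by (simp add: mult_le_cancel_left1 divide_simps)
  also have "\<dots> = ?M ^ e" using assms en by (subst C_const_mult_powr_power) auto
  finally show "real a ^ Suc (e - 1) \<le> ?M ^ Suc (e - 1)" using assms by simp
  show "0 \<le> ?M" using C_const_nonneg[of e d q] assms by simp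
qed

text \<open>If \<open>m = N - e\<close> exceeded the main term, two losses of a factor
  \<open>q - e\<close> against \<open>q\<close> would arise, one from \<open>(q-1)^e\<close> and
  one, with \<open>q + 2\<close> in place of \<open>q\<close>, from the sets not in general
  position. Together they give \<open>(q - e)^2 \<le> q (q - 2e)\<close>, which is absurd.\<close>

lemma le_C_const_of_choose_le:
  fixes N d e q n :: nat
  assumes "e \<ge> 2" "d \<ge> 2" "q > 2 * e" "d * (e - 1) \<le> n"
    and G: "N choose e \<le> G + (N choose (e - 1)) * ((d - 2) * e)"
    and Gq: "G * (q - 1) ^ e \<le> (d - 1) * q ^ (n + 1)"
  shows "real N \<le> C_const q d e * real q powr ((real n - real e + 1) / real e) + real e"
    (is "_ \<le> ?M + _")
proof (rule ccontr)
  assume contra: "\<not> ?thesis"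
  define m where "m = real N - real e"
  have mM: "m > ?M" using contra by (simp add: m_def)
  have M0: "?M \<ge> 0" using C_const_nonneg[of e d q] assms by simp
  then have m0: "m > 0" using mM by simp
  then have Ne: "N > e" by (simp add: m_def)
  have q: "real q > 2 * real e" using assms(3) by (metis of_nat_less_iff of_nat_mult of_nat_numeral)
  obtain c where c: "d = Suc c" using assms by (cases d) auto
  have en: "e \<le> n + 1" using assms c by simp
  \<comment> \<open>\<open>t\<close> is the loss \<open>(d - 2) * e\<close> per
    \<open>(e-1)\<close>-set, times the factor \<open>e\<close> that turns \<open>N choose e\<close>
    into \<open>(m + 1) * K\<close>.\<close>
  define t where "t = (real d - 2) * real e ^ 2"
  define K where "K = real (N choose (e - 1))"
  have "real ((d - 2) * (e * q)) \<le> ?M"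
  proof (rule power_le_C_const_imp_le[OF assms(1-4)])
    show "((d - 2) * (e * q)) ^ e \<le> fact e * (d - 1) * q ^ ((d - 1) * (e - 1))"
    proof (cases "d = 2")
      case False
      then have "d - 1 = d - 2 + 1" "d - 2 \<ge> 1" using assms by auto
      then show ?thesis using power_mult_base_le_fact_mult_power[of "d - 2" e q] assms by simp
    qed (use assms in \<open>simp add: power_0_left\<close>)
  qed
  then have "(real d - 2) * (real e * real q) \<le> m" using mM assms by (simp add: of_nat_diff)
  then have "(real e + 2) * ((real d - 2) * (real e * real q)) \<le> (real e + 2) * m" by simp
  moreover have "(real d - 2) * real e * (real e * (real q + 2)) \<le> (real d - 2) * real e * ((real e + 2) * real q)"
    using q assms by (intro mult_left_mono) (auto simp: algebra_simps)
  ultimately have "t * (real q + 2) \<le> (real e + 2) * m"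
    unfolding t_def by (simp add: algebra_simps power2_eq_square)
  \<comment> \<open>The loss \<open>t\<close> shrinks \<open>m\<close> by at most the factor
    \<open>(q - e) / (q + 2)\<close>; the summand 2 in \<open>C_const\<close> provides the room for
    this.\<close>
  then have L: "m * (real q - real e) \<le> (m - t) * (real q + 2)" by (simp add: algebra_simps)
  have L0: "m - t \<ge> 0"
  proof -
    have "0 \<le> m * (real q - real e)" using m0 q by simp
    with L have "0 \<le> (m - t) * (real q + 2)" by linarith
    then show ?thesis by (simp add: zero_le_mult_iff)
  qed
  have choose: "real e * real (N choose e) = (m + 1) * K"
  proof -
    have "e * (N choose e) = (N - (e - 1)) * (N choose (e - 1))"
      using Suc_mult_choose_Suc[of "e - 1" N] assms by simp
    then have "real (e * (N choose e)) = real ((N - (e - 1)) * (N choose (e - 1)))" by simp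
    moreover have "real (N - (e - 1)) = m + 1" using Ne assms by (simp add: m_def of_nat_diff)
    ultimately show ?thesis by (simp add: K_def)
  qed
  have "real e * real (N choose e) \<le> real e * real (G + (N choose (e - 1)) * ((d - 2) * e))"
    using G by (intro mult_left_mono) (simp_all only: of_nat_le_iff of_nat_0_le_iff)
  moreover have "real ((d - 2) * e) * real e = t"
    using assms by (simp add: of_nat_diff t_def power2_eq_square)
  ultimately have "(m + 1) * K \<le> real e * real G + K * t"
    unfolding choose by (simp only: of_nat_add of_nat_mult flip: K_def) (simp add: algebra_simps)
  then have KG: "K * (m - t) \<le> real e * real G"
    using K_def by (simp add: algebra_simps)
  have mK: "m ^ (e - 1) \<le> fact (e - 1) * K"
  proof -
    have "real ((N - (e - 1)) ^ (e - 1)) \<le> real (fact (e - 1) * (N choose (e - 1)))"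
      using power_diff_le_fact_mult_choose by (simp only: of_nat_le_iff)
    moreover have "m ^ (e - 1) \<le> real (N - (e - 1)) ^ (e - 1)"
      using m0 Ne assms by (intro power_mono) (auto simp: m_def of_nat_diff)
    ultimately show ?thesis by (simp add: K_def)
  qed
  \<comment> \<open>Bernoulli's inequality for \<open>(1 - 1/q)^e\<close>, multiplied by
    \<open>q^e\<close>.\<close>
  have bern: "real q ^ (e - 1) * (real q - real e) \<le> (real q - 1) ^ e"
  proof -
    have q1: "real q > 1" using q assms by simp
    have "1 + real e * (- (1 / real q)) \<le> (1 + - (1 / real q)) ^ e"
      using q1 by (intro Bernoulli_inequality) simp
    then have "real q ^ e * (1 + real e * (- (1 / real q))) \<le> real q ^ e * (1 + - (1 / real q)) ^ e"
      by (intro mult_left_mono) auto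
    also have "\<dots> = (real q - 1) ^ e"
      using q1 by (simp add: power_mult_distrib[symmetric] algebra_simps)
    also have "real q ^ e * (1 + real e * (- (1 / real q))) = real q ^ (e - 1) * (real q - real e)"
      using q1 assms by (simp add: power_eq_if[of _ e] field_simps)
    finally show ?thesis .
  qed
  have Gq': "real G * (real q - 1) ^ e \<le> (real d - 1) * real q ^ (n + 1)"
  proof -
    have "real (G * (q - 1) ^ e) \<le> real ((d - 1) * q ^ (n + 1))" using Gq by (simp only: of_nat_le_iff)
    then show ?thesis using assms by (simp add: of_nat_diff)
  qed
  have fe: "fact e = real e * fact (e - 1)" using assms by (simp add: fact_reduce)
  have me: "m ^ e = m ^ (e - 1) * m" using assms by (simp add: power_eq_if[of _ e])
  have "m ^ e * (real q - real e) \<le> m ^ (e - 1) * ((m - t) * (real q + 2))"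
    using L m0 by (simp add: me mult.assoc)
  also have "\<dots> \<le> (fact (e - 1) * K) * ((m - t) * (real q + 2))"
    using mK L0 by (intro mult_right_mono) auto
  also have "\<dots> = fact (e - 1) * (real q + 2) * (K * (m - t))" by (simp add: mult_ac)
  also have "\<dots> \<le> fact (e - 1) * (real q + 2) * (real e * real G)"
    using KG by (intro mult_left_mono) auto
  finally have 1: "m ^ e * (real q - real e) \<le> fact e * (real q + 2) * real G"
    by (simp add: fe mult_ac)
  have "m ^ e * (real q - real e) * (real q ^ (e - 1) * (real q - real e))
      \<le> m ^ e * (real q - real e) * (real q - 1) ^ e"
    using bern m0 q by (intro mult_left_mono) auto
  also have "\<dots> \<le> fact e * (real q + 2) * real G * (real q - 1) ^ e"
    using 1 q assms by (intro mult_right_mono) auto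
  also have "\<dots> = fact e * (real q + 2) * (real G * (real q - 1) ^ e)" by (simp add: mult_ac)
  also have "\<dots> \<le> fact e * (real q + 2) * ((real d - 1) * real q ^ (n + 1))"
    using Gq' by (intro mult_left_mono) auto
  also have "\<dots> = ?M ^ e * (real q - 2 * real e) * real q ^ e"
  proof -
    have "?M ^ e * (real q - 2 * real e) = fact e * (real d - 1) * real q ^ (n + 1 - e) * (real q + 2)"
      using q assms en by (subst C_const_mult_powr_power) auto
    moreover have "real q ^ (n + 1) = real q ^ (n + 1 - e) * real q ^ e"
      using en by (simp flip: power_add)
    ultimately show ?thesis by (simp add: mult_ac)
  qed
  also have "\<dots> \<le> m ^ e * (real q - 2 * real e) * real q ^ e"
    using mM M0 q by (intro mult_right_mono power_mono) auto
  also have "\<dots> = m ^ e * real q ^ (e - 1) * (real q * (real q - 2 * real e))"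
    using assms by (simp add: power_eq_if[of _ e])
  finally have "m ^ e * real q ^ (e - 1) * ((real q - real e) * (real q - real e))
      \<le> m ^ e * real q ^ (e - 1) * (real q * (real q - 2 * real e))"
    by (simp add: mult_ac)
  moreover have "m ^ e * real q ^ (e - 1) > 0" using m0 q by simp
  ultimately have "(real q - real e) * (real q - real e) \<le> real q * (real q - 2 * real e)"
    by (simp only: mult_le_cancel_left_pos)
  \<comment> \<open>The two sides differ by exactly \<open>e^2\<close>.\<close>
  then have "real e * real e \<le> 0" by (simp add: algebra_simps)
  with assms(1) show False by (simp add: mult_le_0_iff)
qed

section \<open>From projective points to vectors, and the final bound\<close>

lemma proj_points_eq_span_singleton:
  assumes "P \<in> proj_points"
  obtains v where "P = vec.span {v}"
proof -
  have P: "vec.subspace P" "vec.dim P = 1" using assms by (auto simp: proj_points_def)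
  obtain B where B: "B \<subseteq> P" "P \<subseteq> vec.span B" "card B = vec.dim P"
    by (rule vec.basis_exists[of P])
  then obtain v where "B = {v}" using P(2) by (metis card_1_singletonE)
  moreover have "vec.span B \<subseteq> P" by (rule vec.span_minimal[OF B(1) P(1)])
  ultimately show ?thesis using that[of v] B(2) by blast
qed

lemma rs_set_card_le:
  fixes X :: "('a::{field,finite} ^ 'n) set set"
  assumes "CARD('n) = n + 1" "d \<ge> 2" "e \<ge> 2" "CARD('a) > 2 * e" "d * (e - 1) \<le> n"
    and X: "rs_set (d * e - 1) (d * (e - 1)) X"
  shows "real (card X) \<le> C_const CARD('a) d e * real CARD('a) powr ((real n - real e + 1) / real e) + real e"
    (is "_ \<le> ?M + _")
proof -
  have "\<forall>P\<in>X. \<exists>v. P = vec.span {v}"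
    using X proj_points_eq_span_singleton unfolding rs_set_def by (metis subsetD)
  then obtain f where f: "\<And>P. P \<in> X \<Longrightarrow> P = vec.span {f P}" by metis
  have inj: "inj_on f X" using f by (metis inj_onI)
  define V where "V = f ` X"
  have cV: "card V = card X" unfolding V_def using inj by (rule card_image)
  \<comment> \<open>The \<open>(r,s)\<close>-condition in vector form: otherwise some
    \<open>s\<close>-space would contain \<open>d * e = r + 1\<close> points of
    \<open>X\<close>.\<close>
  have H: "d * (e - 1) + 1 < vec.dim U" if U: "U \<subseteq> V" "card U = d * e" for U
  proof (rule ccontr)
    assume "\<not> d * (e - 1) + 1 < vec.dim U"
    then obtain S where S: "vec.subspace S" "U \<subseteq> S" "vec.dim S = d * (e - 1) + 1"
      using subspace_superset_of_dim[of U "d * (e - 1) + 1"] assms(1,5) by auto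
    obtain Z where Z: "Z \<subseteq> X" "U = f ` Z" using U(1) unfolding V_def by (auto simp: subset_image_iff)
    have "card Z = d * e" using Z U inj by (metis card_image inj_on_subset)
    moreover have "Z \<subseteq> {P \<in> X. P \<subseteq> S}"
      using Z S f by (auto, metis empty_subsetI imageI insert_subset subset_iff vec.span_minimal)
    then have "card Z \<le> card {P \<in> X. P \<subseteq> S}" by (intro card_mono) auto
    moreover have "card {P \<in> X. P \<subseteq> S} \<le> d * e - 1"
      using X S by (auto simp: rs_set_def proj_space_def)
    moreover have "d * e > 0" using assms by simp
    ultimately show False by linarith
  qed
  show ?thesis
  \<comment> \<open>The padding to \<open>d * e\<close> elements needs that many vectors; smaller
    sets satisfy the bound because \<open>(d - 1) * e\<close> is at most the main term.\<close>
  proof (cases "d * e \<le> card V")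
    case True
    have "d \<ge> 1" "e \<ge> 1" using assms(2,3) by auto
    note bad = choose_minus_card_general_position_le[OF H \<open>d \<ge> 2\<close> \<open>e \<ge> 1\<close> True]
      and good = general_position_count[OF H \<open>d \<ge> 1\<close> \<open>e \<ge> 1\<close>, unfolded assms(1)]
    show ?thesis
      using le_C_const_of_choose_le[OF assms(3,2,4,5) bad good] unfolding cV .
  next
    case False
    have "((d - 1) * e) ^ e \<le> fact e * (d - 1) * CARD('a) ^ ((d - 1) * (e - 1))"
      using assms by (intro power_mult_le_fact_mult_power) auto
    then have "real ((d - 1) * e) \<le> ?M" by (rule power_le_C_const_imp_le[OF assms(3,2,4,5)])
    moreover have "real (card X) \<le> real ((d - 1) * e) + real e"
    proof -
      have "d * e = (d - 1) * e + e" using assms(2) by (cases d) auto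
      then have "card X \<le> (d - 1) * e + e" using False cV by linarith
      then show ?thesis by (simp only: of_nat_le_iff flip: of_nat_add)
    qed
    ultimately show ?thesis by linarith
  qed
qed

theorem theorem1:
  fixes X :: "('a::{field,finite} ^ 'n) set set"
    and q n d e r s :: nat
  assumes "q = CARD('a)"
    and "CARD('n) = n + 1"
    and "n \<ge> 1"
    and "d \<ge> 2" and "e \<ge> 2"
    and "q > 2 * e"
    and "s = d * (e - 1)"
    and "r = d * e - 1"
    and "s \<le> n"
    and "rs_set r s X"
  shows "real (card X) \<le> C_const q d e * real q powr ((real n - real e + 1) / real e) + real e
    \<and> (s = r - 1 \<and> even s \<longrightarrow>
         d = 2 \<and> e = s div 2 + 1
         \<and> real (card X) \<le> C_const q 2 e * real q powr ((real n - real e + 1) / real e) + real e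
         \<and> C_const q 2 e * real q powr ((real n - real e + 1) / real e) + real e
            = C_const q 2 e * real q powr ((2 * real n - real s) / (real s + 2)) + real e)
    \<and> (r = 2 * s - 1 \<longrightarrow>
         e = 2 \<and> d = s
         \<and> real (card X) \<le> C_const q d 2 * real q powr ((1 / 2) * (real n - 1)) + real e)"
proof -
  have main: "real (card X) \<le> C_const q d e * real q powr ((real n - real e + 1) / real e) + real e"
    using rs_set_card_le[of n d e X] assms by simp
  \<comment> \<open>Thus \<open>r = s + d - 1\<close>, and both special cases become linear
    equations in \<open>s\<close> and \<open>d\<close>.\<close>
  have de: "d * e = s + d" using assms by (cases e) auto
  have two_d: "d = 2 \<and> e = s div 2 + 1" if "s = r - 1"
  proof -
    have "d = 2" using that de assms by linarith
    then show ?thesis using assms by simp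
  qed
  have two_e: "e = 2 \<and> d = s" if "r = 2 * s - 1"
  proof -
    \<comment> \<open>This excludes truncation in \<open>2 * s - 1\<close>, so
      \<open>s + d = 2 * s\<close>.\<close>
    have "s \<ge> 1" using assms by simp
    then have "d = s" using that de assms by linarith
    then have "d * (e - 1) = d * 1" using assms by simp
    then have "e - 1 = 1" using assms(4) by (simp only: mult_cancel1) simp
    then show ?thesis using \<open>d = s\<close> by simp
  qed
  have exponent: "(real n - real e + 1) / real e = (2 * real n - real s) / (real s + 2)" if "d = 2"
  proof -
    have "real e = (real s + 2) / 2" using that assms by (simp add: of_nat_diff)
    then show ?thesis by (simp only:) (simp add: field_simps)
  qed
  have "real (card X) \<le> C_const q d 2 * real q powr ((1 / 2) * (real n - 1)) + real e" if "e = 2"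
    using main that by (simp add: add.commute)
  then show ?thesis using main two_d two_e exponent by auto
qed

end
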